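(* Let $d\ge 1$. Let $W:\mathbb{R}^d\to\mathbb{R}\cup\{\infty\}$ be essentially convex (in particular $W$ satisfies (W0) and (W1)) with $W\ge 0$ on $\mathbb{R}^d$. Let $U:\mathbb{R}^d\to\mathbb{R}$ satisfy (U0), be continuous, and satisfy $\lim_{|\mathbf{x}|\to\infty}U(\mathbf{x})=U_\infty\in\mathbb{R}$. Let $D$ be one of the following: (i) $D=\mathbb{R}^d$; (ii) $D=[x_0,\infty)$ for some $x_0\in\mathbb{R}$, if $d=1$; (iii) $D=\{\mathbf{x}=(x_1,\dots,x_d)\in\mathbb{R}^d: x_d\ge \Phi(\hat{\mathbf{x}})\}$, where $\hat{\mathbf{x}}:=(x_1,\dots,x_{d-1})$ and $\Phi:\mathbb{R}^{d-1}\to\mathbb{R}$ is a continuous function, if $d\ge 2$. Suppose there exists a minimizer $\rho_\infty$ of $E_{W,U}$ in $\mathcal{M}(D)$ whose Euler--Lagrange constant $C_0$ (see context) satisfies $C_0<U_\infty$, and assume $W*\rho_\infty$ is continuous on $\mathbb{R}^d$. Then $\rho_\infty$ is compactly supported. Moreover, some translation and mollification of $\rho_\infty$, i.e. $\rho_\sharp(\mathbf{x})=(\rho_\infty*\phi_\epsilon)(\mathbf{x}-\mathbf{h})$ for some mollifier $\phi$, some $\epsilon>0$ and some $\mathbf{h}\in\mathbb{R}^d$, satisfies all of the following: $\rho_\sharp\in\mathcal{M}(D)$ is a compactly supported locally integrable function, $\mathrm{supp}\,\rho_\sharp=\bar{\mathcal{S}}$ for some open set $\mathcal{S}$ with $\partial\mathcal{S}$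 having zero Lebesgue measure, $W*\rho_\sharp$ is continuous on $\mathbb{R}^d$, and $\sup_{\mathcal{S}}V[\rho_\sharp]<U_\infty$.
   Context: $\mathcal{M}(\mathbb{R}^d)$ is the set of Borel probability measures on $\mathbb{R}^d$; for closed $D\subset\mathbb{R}^d$, $\mathcal{M}(D)$ is the set of those supported in $D$. A measure is called a locally integrable function if it has a locally integrable density with respect to Lebesgue measure. (W0): $W:\mathbb{R}^d\to\mathbb{R}\cup\{\infty\}$ is locally integrable, bounded from below and lower-semicontinuous, with $W(\mathbf{x})=W(-\mathbf{x})$. (W1): $W$ is continuous on $\mathbb{R}^d\setminus\{0\}$, $W(0)=\lim_{\mathbf{x}\to 0}W(\mathbf{x})\in\mathbb{R}\cup\{\infty\}$, and for any $R>0$ there are constants $C_1(R),C_2(R)$ with $\frac{1}{|B(\mathbf{x};\epsilon)|}\int_{B(\mathbf{x};\epsilon)}W(\mathbf{y})\,d\mathbf{y}\le C_1(R)+C_2(R)W(\mathbf{x})$ for all $|\mathbf{x}|<R$, $0<\epsilon<1$. (U0): $U:\mathbb{R}^d\to\mathbb{R}\cup\{\infty\}$ is locally integrable, bounded from below and lower-semicontinuous. Essentially convex: $W\in C^2(\mathbb{R}^d\setminus\{0\})$ satisfying (W0), (W1) is essentially convex if $\Delta W>0$ on $\mathbb{R}^d\setminus\{0\}$ and, for some $-d<b<\min\{2-d,0\}$ and $-d<a<\min\{2-d,0\}$, $|W|\lesssim|\mathbf{x}|^{b}$, $|\nabla W|\lesssim|\mathbf{x}|^{b-1}$, $|\Delta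 W|\lesssim|\mathbf{x}|^{b-2}$ for $0<|\mathbf{x}|<1$, and $|W|\lesssim|\mathbf{x}|^{a}$, $|\nabla W|\lesssim|\mathbf{x}|^{a-1}$, $|\Delta W|\lesssim|\mathbf{x}|^{a-2}$ for $|\mathbf{x}|\ge1$ (where $\lesssim$ means $\le$ up to a multiplicative constant). Energy: $E_{W,U}[\rho]=\frac12\int\int W(\mathbf{x}-\mathbf{y})\,d\rho(\mathbf{y})\,d\rho(\mathbf{x})+\int U(\mathbf{x})\,d\rho(\mathbf{x})\in\mathbb{R}\cup\{\infty\}$. Generated potential: $V[\rho]=W*\rho+U$, where $(W*\rho)(\mathbf{x})=\int W(\mathbf{x}-\mathbf{y})\,d\rho(\mathbf{y})$. Euler--Lagrange constant: if $\rho\in\mathcal{M}(D)$ is a minimizer of $E_{W,U}$ in $\mathcal{M}(D)$ (with $\inf_{\mathcal{M}(D)}E_{W,U}<\infty$), there is a constant $C_0\in\mathbb{R}$ with $V[\rho]\le C_0$ on $\mathrm{supp}\,\rho$, $V[\rho]\ge C_0$ a.e. in $D$, and $V[\rho]=C_0$ $\rho$-a.e. (a standard fact); this $C_0$ is the constant referred to in the claim. A mollifier $\phi$ is a smooth radially-decreasing nonnegative function supported on $\overline{B(0;1)}$ with $\int_{\mathbb{R}^d}\phi\,d\mathbf{x}=1$, and $\phi_\epsilon(\mathbf{x})=\epsilon^{-d}\phi(\mathbf{x}/\epsilon)$. *)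

theory Defs
  imports "HOL-Probability.Probability"
begin

subsection \<open>Differentiability classes on open subsets of Euclidean space\<close>

definition partial_deriv :: "'d::finite \<Rightarrow> (real^'d \<Rightarrow> real) \<Rightarrow> real^'d \<Rightarrow> real" where
  "partial_deriv i f x = frechet_derivative f (at x) (axis i 1)"

text \<open>Only meant for open \<open>S\<close>, where \<open>at x\<close> and \<open>at x within S\<close> agree for \<open>x \<in> S\<close>.\<close>

primrec Ck_on :: "nat \<Rightarrow> (real^'d::finite \<Rightarrow> real) \<Rightarrow> (real^'d) set \<Rightarrow> bool" where
  "Ck_on 0 f S \<longleftrightarrow> continuous_on S f"
| "Ck_on (Suc k) f S \<longleftrightarrow> f differentiable_on S \<and> (\<forall>i. Ck_on k (partial_deriv i f) S)"

definition grad :: "(real^'d::finite \<Rightarrow> real) \<Rightarrow> real^'d \<Rightarrow> real^'d" where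
  "grad f x = (\<chi> i. partial_deriv i f x)"

definition laplacian :: "(real^'d::finite \<Rightarrow> real) \<Rightarrow> real^'d \<Rightarrow> real" where
  "laplacian f x = (\<Sum>i\<in>UNIV. partial_deriv i (partial_deriv i f) x)"

subsection \<open>Extended-real-valued functions\<close>

text \<open>Integral of an extended-real-valued function as the difference of the integrals of its
  positive and negative parts (\<open>e2ennreal\<close> sends negative values to 0). It is only
  meaningful if one of the two is finite, which holds below because all integrands are
  bounded from below and all measures, or the regions of integration, are finite.\<close>

definition eint :: "'a measure \<Rightarrow> ('a \<Rightarrow> ereal) \<Rightarrow> ereal" where
  "eint M f = enn2ereal (\<integral>\<^sup>+x. e2ennreal (f x) \<partial>M) - enn2ereal (\<integral>\<^sup>+x. e2ennreal (- f x) \<partial>M)"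

definition locally_integrable :: "(real^'d::finite \<Rightarrow> ereal) \<Rightarrow> bool" where
  "locally_integrable f \<longleftrightarrow> f \<in> borel_measurable lborel \<and>
     (\<forall>K. compact K \<longrightarrow> (\<integral>\<^sup>+x\<in>K. e2ennreal \<bar>f x\<bar> \<partial>lborel) < \<infinity>)"

definition bounded_from_below :: "('a \<Rightarrow> ereal) \<Rightarrow> bool" where
  "bounded_from_below f \<longleftrightarrow> (\<exists>m::real. \<forall>x. ereal m \<le> f x)"

definition lower_semicontinuous :: "('a::topological_space \<Rightarrow> ereal) \<Rightarrow> bool" where
  "lower_semicontinuous f \<longleftrightarrow> (\<forall>x. f x \<le> Liminf (at x) f)"

definition real_continuous :: "('a::topological_space \<Rightarrow> ereal) \<Rightarrow> bool" where
  "real_continuous f \<longleftrightarrow> (\<forall>x. \<bar>f x\<bar> \<noteq> \<infinity>) \<and> continuous_on UNIV f"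

subsection \<open>Assumptions on the potentials\<close>

text \<open>Boundedness from below excludes the value \<open>- \<infinity>\<close>.\<close>

definition U0 :: "(real^'d::finite \<Rightarrow> ereal) \<Rightarrow> bool" where
  "U0 U \<longleftrightarrow> locally_integrable U \<and> bounded_from_below U \<and> lower_semicontinuous U"

definition W0 :: "(real^'d::finite \<Rightarrow> ereal) \<Rightarrow> bool" where
  "W0 W \<longleftrightarrow> locally_integrable W \<and> bounded_from_below W \<and> lower_semicontinuous W \<and>
     (\<forall>x. W x = W (- x))"

definition W1 :: "(real^'d::finite \<Rightarrow> ereal) \<Rightarrow> bool" where
  "W1 W \<longleftrightarrow> continuous_on (- {0}) W \<and> (W \<longlongrightarrow> W 0) (at 0) \<and>
     (\<forall>R>0. \<exists>C1 C2 :: real. \<forall>x \<epsilon>. norm x < R \<longrightarrow> 0 < \<epsilon> \<longrightarrow> \<epsilon> < 1 \<longrightarrow>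
        ereal (1 / measure lborel (ball x \<epsilon>)) * eint lborel (\<lambda>y. W y * indicator (ball x \<epsilon>) y)
          \<le> ereal C1 + ereal C2 * W x)"

definition essentially_convex :: "(real^'d::finite \<Rightarrow> ereal) \<Rightarrow> bool" where
  "essentially_convex W \<longleftrightarrow>
     W0 W \<and> W1 W \<and> (\<forall>x. x \<noteq> 0 \<longrightarrow> \<bar>W x\<bar> \<noteq> \<infinity>) \<and>
     (let w = (\<lambda>x. real_of_ereal (W x)); d = real CARD('d) in
       Ck_on 2 w (- {0}) \<and>
       (\<forall>x. x \<noteq> 0 \<longrightarrow> laplacian w x > 0) \<and>
       (\<exists>b a. - d < b \<and> b < min (2 - d) 0 \<and> - d < a \<and> a < min (2 - d) 0 \<and>
         (\<exists>C. \<forall>x. 0 < norm x \<and> norm x < 1 \<longrightarrow>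
            \<bar>w x\<bar> \<le> C * norm x powr b \<and>
            norm (grad w x) \<le> C * norm x powr (b - 1) \<and>
            \<bar>laplacian w x\<bar> \<le> C * norm x powr (b - 2)) \<and>
         (\<exists>C. \<forall>x. 1 \<le> norm x \<longrightarrow>
            \<bar>w x\<bar> \<le> C * norm x powr a \<and>
            norm (grad w x) \<le> C * norm x powr (a - 1) \<and>
            \<bar>laplacian w x\<bar> \<le> C * norm x powr (a - 2))))"

subsection \<open>Measures, energies and minimizers\<close>

definition msupp :: "(real^'d::finite) measure \<Rightarrow> (real^'d) set" where
  "msupp \<rho> = {x. \<forall>r>0. emeasure \<rho> (ball x r) > 0}"

definition prob_measures :: "(real^'d::finite) set \<Rightarrow> (real^'d) measure set" where
  "prob_measures D = {\<rho>. sets \<rho> = sets borel \<and> prob_space \<rho> \<and> msupp \<rho> \<subseteq> D}"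

definition is_loc_int_function :: "(real^'d::finite) measure \<Rightarrow> bool" where
  "is_loc_int_function \<rho> \<longleftrightarrow> (\<exists>f. (\<forall>x. 0 \<le> f x) \<and> locally_integrable (\<lambda>x. ereal (f x)) \<and>
     \<rho> = density lborel (\<lambda>x. ennreal (f x)))"

definition conv_measure :: "(real^'d::finite \<Rightarrow> ereal) \<Rightarrow> (real^'d) measure \<Rightarrow> real^'d \<Rightarrow> ereal" where
  "conv_measure W \<rho> x = eint \<rho> (\<lambda>y. W (x - y))"

definition energy ::
    "(real^'d::finite \<Rightarrow> ereal) \<Rightarrow> (real^'d \<Rightarrow> ereal) \<Rightarrow> (real^'d) measure \<Rightarrow> ereal" where
  "energy W U \<rho> = ereal (1/2) * eint \<rho> (\<lambda>x. eint \<rho> (\<lambda>y. W (x - y))) + eint \<rho> U"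

definition gen_potential ::
    "(real^'d::finite \<Rightarrow> ereal) \<Rightarrow> (real^'d \<Rightarrow> ereal) \<Rightarrow> (real^'d) measure \<Rightarrow> real^'d \<Rightarrow> ereal" where
  "gen_potential W U \<rho> x = conv_measure W \<rho> x + U x"

definition is_minimizer ::
    "(real^'d::finite \<Rightarrow> ereal) \<Rightarrow> (real^'d \<Rightarrow> ereal) \<Rightarrow> (real^'d) set \<Rightarrow> (real^'d) measure \<Rightarrow> bool" where
  "is_minimizer W U D \<rho> \<longleftrightarrow>
     \<rho> \<in> prob_measures D \<and> (\<forall>\<mu>\<in>prob_measures D. energy W U \<rho> \<le> energy W U \<mu>)"

text \<open>The last condition determines the constant uniquely.\<close>

definition is_EL_constant ::
    "(real^'d::finite \<Rightarrow> ereal) \<Rightarrow> (real^'d \<Rightarrow> ereal) \<Rightarrow> (real^'d) set \<Rightarrow> (real^'d) measure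
      \<Rightarrow> real \<Rightarrow> bool" where
  "is_EL_constant W U D \<rho> C0 \<longleftrightarrow>
     (\<forall>x\<in>msupp \<rho>. gen_potential W U \<rho> x \<le> ereal C0) \<and>
     (AE x in lborel. x \<in> D \<longrightarrow> gen_potential W U \<rho> x \<ge> ereal C0) \<and>
     (AE x in \<rho>. gen_potential W U \<rho> x = ereal C0)"

text \<open>The coordinates of \<open>real^'d\<close> carry no order, so any index \<open>k\<close> may play the role of the last
  one. \<open>\<real>\<^sup>d\<^sup>-\<^sup>1\<close> is identified with the hyperplane \<open>x\<^sub>k = 0\<close>, and the vector \<open>x\<close> with its \<open>k\<close>-th
  coordinate dropped with its projection to that hyperplane.\<close>

definition admissible_domain :: "(real^'d::finite) set \<Rightarrow> bool" where
  "admissible_domain D \<longleftrightarrow>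
     D = UNIV \<or>
     CARD('d) = 1 \<and> (\<exists>x0. D = {x. \<forall>i. x $ i \<ge> x0}) \<or>
     CARD('d) \<ge> 2 \<and> (\<exists>k \<Phi>. continuous_on {y. y $ k = 0} \<Phi> \<and>
        D = {x. x $ k \<ge> \<Phi> (\<chi> i. if i = k then 0 else x $ i)})"

subsection \<open>Mollification\<close>

text \<open>The monotonicity condition also forces \<open>\<phi>\<close> to be radial.\<close>

definition mollifier :: "(real^'d::finite \<Rightarrow> real) \<Rightarrow> bool" where
  "mollifier \<phi> \<longleftrightarrow> (\<forall>k. Ck_on k \<phi> UNIV) \<and> (\<forall>x. 0 \<le> \<phi> x) \<and>
     (\<forall>x y. norm x \<le> norm y \<longrightarrow> \<phi> y \<le> \<phi> x) \<and>
     closure {x. \<phi> x \<noteq> 0} \<subseteq> cball 0 1 \<and> (\<integral>x. \<phi> x \<partial>lborel) = 1"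

definition rescale :: "(real^'d::finite \<Rightarrow> real) \<Rightarrow> real \<Rightarrow> real^'d \<Rightarrow> real" where
  "rescale \<phi> \<epsilon> x = \<phi> (x /\<^sub>R \<epsilon>) / \<epsilon> ^ CARD('d)"

definition mollify ::
    "(real^'d::finite) measure \<Rightarrow> (real^'d \<Rightarrow> real) \<Rightarrow> real \<Rightarrow> real^'d \<Rightarrow> real" where
  "mollify \<rho> \<phi> \<epsilon> x = (\<integral>y. rescale \<phi> \<epsilon> (x - y) \<partial>\<rho>)"

definition translated_mollification ::
    "(real^'d::finite) measure \<Rightarrow> (real^'d \<Rightarrow> real) \<Rightarrow> real \<Rightarrow> real^'d \<Rightarrow> (real^'d) measure" where
  "translated_mollification \<rho> \<phi> \<epsilon> h = density lborel (\<lambda>x. ennreal (mollify \<rho> \<phi> \<epsilon> (x - h)))"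

end

theory Submission
  imports Defs
begin

text \<open>Write \<open>G\<close> for the continuous potential of \<open>\<rho>\<close> and \<open>K\<close> for its support. On \<open>K\<close> the Euler--Lagrange
  condition gives \<open>G + U \<le> C0\<close>. Because \<open>W\<close>, and therefore \<open>G\<close>, is nonnegative, \<open>U \<le> C0 < U_inf\<close> on
  \<open>K\<close>, whereas \<open>U\<close> tends to \<open>U_inf\<close> at infinity; hence the closed set \<open>K\<close> is bounded.

  The inequality \<open>G + U \<le> C0\<close> leaves a gap to \<open>U_inf\<close>, and everything else is a small perturbation that
  does not use up the gap. Convolution is commutative, so the potential of the mollified measure is the
  mollification of \<open>G\<close> (\<open>nn_integral_potential_smoothed\<close>). It is continuous again
  (\<open>continuous_kernel_average\<close>), and near the compact set \<open>K\<close> uniform continuity keeps it within a small \<open>\<delta>\<close> of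
  the values of \<open>G\<close> on \<open>K\<close>; in the same way \<open>U\<close> changes by at most \<open>\<delta>\<close>. A small shift moves \<open>D\<close>
  into its interior (\<open>admissible_domain_push_inside\<close>), and by compactness of \<open>K\<close> a small enough
  mollification of the shifted measure stays in \<open>D\<close>.

  The mollifier is the usual bump function \<open>exp (- 1 / (1 - x \<bullet> x))\<close>, normalised
  (\<open>mollifier_exists\<close>). It is positive on the whole open unit ball, so the mollified density is positive
  exactly on the open set \<open>S\<close> of points at distance less than \<open>\<epsilon>\<close> from the shifted \<open>K\<close>. The boundary
  of \<open>S\<close> is contained in the level set \<open>\<epsilon>\<close> of the distance function; these level sets are disjoint
  and for bounded \<open>\<epsilon>\<close> they lie in a set of finite measure, so all but countably many \<open>\<epsilon>\<close> give
  a null set (\<open>null_distance_sphere\<close>).\<close>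

section \<open>A smooth mollifier that is positive on the open unit ball\<close>

text \<open>For \<open>j = 0\<close> this is the classical function \<open>exp (- 1 / t)\<close> that is flat at the origin. The factors
  \<open>t powi - j\<close> make the family closed under differentiation up to linear combinations, which turns
  smoothness into a single induction.\<close>

definition flat :: "nat \<Rightarrow> real \<Rightarrow> real" where
  "flat j t = (if t > 0 then exp (- inverse t) * inverse t ^ j else 0)"

lemma flat_tendsto_0: "(flat j \<longlongrightarrow> 0) (at 0)"
proof -
  have "((\<lambda>t. inverse t ^ j / exp (inverse t)) \<longlongrightarrow> (0::real)) (at_right 0)"
    by (rule filterlim_compose[OF tendsto_power_div_exp_0 filterlim_inverse_at_top_right])
  then have r: "(flat j \<longlongrightarrow> 0) (at_right 0)"
    by (rule Lim_transform_eventually)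
      (auto simp: eventually_at_filter flat_def exp_minus field_simps)
  have l: "(flat j \<longlongrightarrow> 0) (at_left 0)"
    by (rule Lim_transform_eventually[OF tendsto_const[of 0]])
      (auto simp: eventually_at_filter flat_def)
  from l r show ?thesis by (simp add: filterlim_at_split)
qed

text \<open>At the origin the difference quotient of \<open>flat j\<close> is \<open>flat (j + 1)\<close> itself, so there the derivative
  is 0 because every member of the family is infinitesimal.\<close>

lemma flat_DERIV:
  "(flat j has_real_derivative flat (j + 2) t - real j * flat (j + 1) t) (at t)"
proof (cases t "0::real" rule: linorder_cases)
  case less
  have "((\<lambda>_. 0) has_real_derivative 0) (at t)" by simp
  then have "(flat j has_real_derivative 0) (at t)"
    by (rule has_field_derivative_transform_within_open[where S = "{..<0}"])
      (use less in \<open>auto simp: flat_def\<close>)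
  with less show ?thesis by (simp add: flat_def)
next
  case equal
  have "((\<lambda>y. (flat j y - flat j 0) / (y - 0)) \<longlongrightarrow> 0) (at 0)"
    by (rule Lim_transform_eventually[OF flat_tendsto_0[of "Suc j"]])
      (auto simp: flat_def eventually_at_filter field_simps)
  with equal show ?thesis by (simp add: has_field_derivative_iff flat_def)
next
  case greater
  have e: "((\<lambda>t. exp (- inverse t)) has_real_derivative exp (- inverse t) * inverse t ^ 2) (at t)"
    using greater by (auto intro!: derivative_eq_intros simp: power2_eq_square)
  have p: "((\<lambda>t. inverse t ^ j) has_real_derivative - real j * inverse t ^ (j + 1)) (at t)"
  proof (cases j)
    case (Suc n)
    show ?thesis unfolding Suc
      by (rule DERIV_cong[OF DERIV_power[OF DERIV_inverse]]) (use greater in \<open>simp_all add: algebra_simps\<close>)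
  qed simp
  have "((\<lambda>t. exp (- inverse t) * inverse t ^ j) has_real_derivative
      exp (- inverse t) * inverse t ^ (j + 2) - real j * (exp (- inverse t) * inverse t ^ (j + 1))) (at t)"
    using DERIV_mult[OF e p] by (simp add: algebra_simps power2_eq_square)
  then have "(flat j has_real_derivative
      exp (- inverse t) * inverse t ^ (j + 2) - real j * (exp (- inverse t) * inverse t ^ (j + 1))) (at t)"
    by (rule has_field_derivative_transform_within_open[where S = "{0<..}"])
      (use greater in \<open>auto simp: flat_def\<close>)
  with greater show ?thesis by (simp add: flat_def)
qed

lemma flat_0_mono: "s \<le> t \<Longrightarrow> flat 0 s \<le> flat 0 t"
  by (auto simp: flat_def le_imp_inverse_le)

lemma flat_pos_iff: "flat j t > 0 \<longleftrightarrow> t > 0"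
  by (auto simp: flat_def)

lemma partial_deriv_eqI:
  "(f has_derivative f') (at x) \<Longrightarrow> partial_deriv i f x = f' (axis i 1)"
  unfolding partial_deriv_def by (simp flip: frechet_derivative_at)

lemma Ck_on_SucI:
  fixes f :: "real^'d::finite \<Rightarrow> real"
  assumes "\<And>x. (f has_derivative f' x) (at x)"
    and "\<And>i. Ck_on k (\<lambda>x. f' x (axis i 1)) UNIV"
  shows "Ck_on (Suc k) f UNIV"
proof -
  have "partial_deriv i f = (\<lambda>x. f' x (axis i 1))" for i
    using partial_deriv_eqI[OF assms(1)] by auto
  moreover have "f differentiable_on UNIV"
    using assms(1) by (auto simp: differentiable_on_def differentiable_def)
  ultimately show ?thesis using assms(2) by simp
qed

lemma Ck_on_Suc_has_derivative:
  fixes f :: "real^'d::finite \<Rightarrow> real"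
  assumes "Ck_on (Suc k) f UNIV"
  shows "(f has_derivative frechet_derivative f (at x)) (at x)"
  using assms by (auto simp: differentiable_on_def frechet_derivative_works)

lemma Ck_on_SucD: "Ck_on (Suc k) f S \<Longrightarrow> Ck_on k f S"
proof (induction k arbitrary: f)
  case 0
  then show ?case by (auto intro: differentiable_imp_continuous_on)
next
  case (Suc k)
  then show ?case by (metis Ck_on.simps(2))
qed

lemma Ck_on_const: "Ck_on k (\<lambda>_::real^'d::finite. c) UNIV"
proof (induction k arbitrary: c)
  case (Suc k)
  show ?case by (rule Ck_on_SucI[where f' = "\<lambda>_ _. 0"]) (use Suc in \<open>auto intro: has_derivative_const\<close>)
qed simp

lemma Ck_on_nth: "Ck_on k (\<lambda>x::real^'d::finite. x $ i) UNIV"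
proof (cases k)
  case (Suc k)
  show ?thesis unfolding Suc
    by (rule Ck_on_SucI[where f' = "\<lambda>_ v. v $ i"])
      (auto intro: Ck_on_const bounded_linear_imp_has_derivative bounded_linear_vec_nth)
qed (simp add: continuous_on_component)

lemma Ck_on_add:
  "Ck_on k f UNIV \<Longrightarrow> Ck_on k g UNIV \<Longrightarrow> Ck_on k (\<lambda>x::real^'d::finite. f x + g x) UNIV"
proof (induction k arbitrary: f g)
  case (Suc k)
  have "Ck_on k (\<lambda>x. partial_deriv i f x + partial_deriv i g x) UNIV" for i
    using Suc by simp
  then show ?case
    by (intro Ck_on_SucI[OF has_derivative_add[OF Suc.prems[THEN Ck_on_Suc_has_derivative]]])
       (simp add: partial_deriv_def)
qed (simp add: continuous_on_add)

lemma Ck_on_mult: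
  "Ck_on k f UNIV \<Longrightarrow> Ck_on k g UNIV \<Longrightarrow> Ck_on k (\<lambda>x::real^'d::finite. f x * g x) UNIV"
proof (induction k arbitrary: f g)
  case (Suc k)
  have "Ck_on k (\<lambda>x. f x * partial_deriv i g x + partial_deriv i f x * g x) UNIV" for i
    using Suc.prems[THEN Ck_on_SucD] Suc.prems by (intro Ck_on_add Suc.IH) auto
  then show ?case
    by (intro Ck_on_SucI[OF has_derivative_mult[OF Suc.prems[THEN Ck_on_Suc_has_derivative]]])
       (simp add: partial_deriv_def)
qed (simp add: continuous_on_mult)

text \<open>By the chain rule a partial derivative is again a combination of members of the family
  \<open>flat j (1 - x \<bullet> x)\<close> with polynomial coefficients. Hence the induction on the order of
  differentiability has to be over all \<open>j\<close> at once.\<close>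

lemma Ck_on_flat_bump: "Ck_on k (\<lambda>x::real^'d::finite. flat j (1 - x \<bullet> x)) UNIV"
proof (induction k arbitrary: j)
  case 0
  have "isCont (flat j) t" for t by (rule DERIV_isCont[OF flat_DERIV])
  then have "continuous_on UNIV (flat j)" by (simp add: continuous_at_imp_continuous_on)
  then show ?case
    by (auto intro!: continuous_on_compose2[of UNIV "flat j"] continuous_intros)
next
  case (Suc k)
  let ?F = "\<lambda>x::real^'d. flat (j + 2) (1 - x \<bullet> x) + (- real j) * flat (j + 1) (1 - x \<bullet> x)"
  have "((\<lambda>x. flat j (1 - x \<bullet> x)) has_derivative (\<lambda>v. ?F x * (- 2 * (x \<bullet> v)))) (at x)" for x :: "real^'d"
  proof -
    have "((\<lambda>x. 1 - x \<bullet> x) has_derivative (\<lambda>v. - 2 * (x \<bullet> v))) (at x)"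
      by (auto intro!: derivative_eq_intros simp: inner_commute)
    from has_derivative_compose[OF this flat_DERIV[of j, unfolded has_field_derivative_def]]
    show ?thesis by simp
  qed
  moreover have "Ck_on k (\<lambda>x. ?F x * (- 2 * (x \<bullet> axis i 1))) UNIV" for i
    by (intro Ck_on_mult Ck_on_add Ck_on_const Suc.IH) (simp add: inner_axis Ck_on_nth)
  ultimately show ?case by (rule Ck_on_SucI)
qed

text \<open>The support of the mollifier is required to be the whole unit ball, and not just a part of it, so
  that the set where a mollified measure has positive density is exactly a neighbourhood of constant
  radius of the support.\<close>

lemma mollifier_exists:
  obtains \<phi> :: "real^'d::finite \<Rightarrow> real"
  where "mollifier \<phi>" "\<And>x. \<phi> x > 0 \<longleftrightarrow> norm x < 1"
proof -
  define b where "b = (\<lambda>x::real^'d. flat 0 (1 - x \<bullet> x))"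
  define c where "c = (\<integral>x. b x \<partial>lborel)"
  have b_cont: "continuous_on UNIV b"
    using Ck_on_flat_bump[of 0 0] by (simp add: b_def)
  have b_nonneg: "b x \<ge> 0" for x by (simp add: b_def flat_def)
  have b_pos: "b x > 0 \<longleftrightarrow> norm x < 1" for x
    by (simp add: b_def flat_pos_iff dot_square_norm power_less_one_iff)
  have b_zero: "b x = 0" if "norm x \<ge> 1" for x
    using b_pos[of x] b_nonneg[of x] that by linarith
  have ibd: "integrable lborel (\<lambda>x. indicator (cball 0 1) x *\<^sub>R b x)"
    using continuous_on_subset[OF b_cont] by (intro borel_integrable_compact) auto
  moreover have "(\<lambda>x. indicator (cball 0 1) x *\<^sub>R b x) = b"
    using b_zero by (auto simp: fun_eq_iff indicator_def)
  ultimately have b_int: "integrable lborel b" by simp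
  have "c > 0"
  proof -
    have "c \<noteq> 0"
    proof
      assume "c = 0"
      then have "AE x in lborel. b x = 0"
        using integral_nonneg_eq_0_iff_AE[OF b_int] b_nonneg by (auto simp: c_def)
      moreover have "{x \<in> space lborel. \<not> b x = 0} = ball 0 1"
      proof (intro set_eqI)
        show "x \<in> {x \<in> space lborel. \<not> b x = 0} \<longleftrightarrow> x \<in> ball 0 1" for x
          using b_pos[of x] b_zero[of x] by (cases "norm x < 1") auto
      qed
      ultimately have "emeasure lborel (ball (0::real^'d) 1) = 0"
        using AE_iff_measurable[of "ball 0 1" lborel "\<lambda>x. b x = 0"] by simp
      then have "measure lborel (ball (0::real^'d) 1) = 0"
        by (simp add: measure_def)
      with content_ball_pos[of 1 "0::real^'d"] show False by simp
    qed
    moreover have "c \<ge> 0" unfolding c_def using b_nonneg by simp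
    ultimately show ?thesis by simp
  qed
  show thesis
  proof
    show "inverse c * b x > 0 \<longleftrightarrow> norm x < 1" for x
      using \<open>c > 0\<close> b_pos by (simp add: zero_less_mult_iff)
    show "mollifier (\<lambda>x. inverse c * b x)"
      unfolding mollifier_def
    proof (intro conjI allI impI)
      show "Ck_on k (\<lambda>x. inverse c * b x) UNIV" for k
        unfolding b_def by (intro Ck_on_mult Ck_on_const Ck_on_flat_bump)
      show "inverse c * b y \<le> inverse c * b x" if "norm x \<le> norm y" for x y
        using \<open>c > 0\<close> that by (auto simp: b_def dot_square_norm intro!: mult_left_mono flat_0_mono power_mono)
      show "closure {x. inverse c * b x \<noteq> 0} \<subseteq> cball 0 1"
        using b_zero by (intro closure_minimal) (auto simp: not_le[symmetric] intro: ccontr)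
    qed (use \<open>c > 0\<close> b_nonneg b_int in \<open>auto simp: c_def\<close>)
  qed
qed

section \<open>Supports and distance neighbourhoods\<close>

text \<open>The complement of the support is a union of null balls, and by the Lindelof property countably many
  of them suffice.\<close>

lemma AE_in_msupp:
  fixes M :: "(real^'d::finite) measure"
  assumes "sets M = sets borel"
  shows "AE x in M. x \<in> msupp M"
proof -
  define \<F> where "\<F> = {ball x r | x r. emeasure M (ball x r) = 0}"
  obtain \<G> where G: "\<G> \<subseteq> \<F>" "countable \<G>" "\<Union>\<G> = \<Union>\<F>"
    using Lindelof[of \<F>] by (auto simp: \<F>_def)
  have "\<Union>\<G> \<in> null_sets M"
  proof -
    have "B \<in> null_sets M" if "B \<in> \<G>" for B
      using that G(1) assms by (auto simp: \<F>_def null_sets_def)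
    then show ?thesis using null_sets_UN'[OF G(2), of "\<lambda>B. B" M] by simp
  qed
  moreover have "x \<in> msupp M" if "x \<notin> \<Union>\<G>" for x
  proof -
    have "emeasure M (ball x r) \<noteq> 0" if "r > 0" for r
      using \<open>x \<notin> \<Union>\<G>\<close> that unfolding G(3) \<F>_def by force
    then show ?thesis by (auto simp: msupp_def zero_less_iff_neq_zero)
  qed
  ultimately show ?thesis by (auto elim!: AE_not_in[THEN eventually_mono])
qed

lemma not_in_msupp_if_null_open:
  fixes M :: "(real^'d::finite) measure"
  assumes "sets M = sets borel" "open A" "emeasure M A = 0" "x \<in> A"
  shows "x \<notin> msupp M"
proof -
  obtain r where "r > 0" "ball x r \<subseteq> A" using assms openE by blast
  then have "emeasure M (ball x r) \<le> 0"
    using emeasure_mono[of "ball x r" A M] assms by auto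
  then show ?thesis using \<open>r > 0\<close> by (force simp: msupp_def)
qed

lemma msupp_subset_closed:
  fixes M :: "(real^'d::finite) measure"
  assumes "sets M = sets borel" "closed C" "AE x in M. x \<in> C"
  shows "msupp M \<subseteq> C"
proof -
  have "emeasure M (- C) = 0"
    using assms AE_iff_null_sets[of "- C" M] by auto
  then show ?thesis
    using not_in_msupp_if_null_open[of M "- C"] assms by auto
qed

lemma msupp_closed:
  fixes M :: "(real^'d::finite) measure"
  assumes "sets M = sets borel"
  shows "closed (msupp M)"
proof -
  have "\<exists>r>0. ball x r \<subseteq> - msupp M" if "x \<notin> msupp M" for x
  proof -
    obtain r where "r > 0" "emeasure M (ball x r) = 0"
      using \<open>x \<notin> msupp M\<close> by (auto simp: msupp_def zero_less_iff_neq_zero)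
    then show ?thesis
      using not_in_msupp_if_null_open[OF assms, of "ball x r"] by blast
  qed
  then show ?thesis
    by (auto simp: closed_def open_contains_ball)
qed

lemma msupp_density_lborel:
  fixes f :: "real^'d::finite \<Rightarrow> real"
  assumes f: "f \<in> borel_measurable borel" and S: "open {x. f x > 0}"
  shows "msupp (density lborel (\<lambda>x. ennreal (f x))) = closure {x. f x > 0}"
    (is "msupp ?M = closure ?S")
proof
  have "AE x in ?M. x \<in> closure ?S"
    using closure_subset[of ?S] f by (auto simp: AE_density ennreal_eq_0_iff less_le not_le intro!: AE_I2)
  then show "msupp ?M \<subseteq> closure ?S"
    by (intro msupp_subset_closed) auto
  have "x \<in> msupp ?M" if "f x > 0" for x
  proof -
    have "emeasure ?M (ball x r) \<noteq> 0" if "r > 0" for r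
    proof
      assume "emeasure ?M (ball x r) = 0"
      then have "AE y in ?M. y \<notin> ball x r"
        by (intro AE_not_in) (auto simp: null_sets_def)
      then have ae: "AE y in lborel. y \<notin> ball x r \<inter> ?S"
        using f by (simp add: AE_density) (auto elim: eventually_mono)
      have "open (ball x r \<inter> ?S)" "x \<in> ball x r \<inter> ?S"
        using S \<open>f x > 0\<close> \<open>r > 0\<close> by auto
      then obtain s where s: "s > 0" "ball x s \<subseteq> ball x r \<inter> ?S" using openE by blast
      from ae have "AE y in lborel. y \<notin> ball x s"
        by eventually_elim (use s in auto)
      then have "emeasure lborel (ball x s) = 0"
        using AE_iff_null_sets[of "ball x s" lborel] by auto
      then show False
        using content_ball_pos[OF \<open>s > 0\<close>, of x] by (simp add: measure_def)
    qed
    then show ?thesis by (auto simp: msupp_def zero_less_iff_neq_zero)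
  qed
  then show "closure ?S \<subseteq> msupp ?M"
    by (intro closure_minimal msupp_closed) auto
qed

text \<open>The image under \<open>g\<close> of Lebesgue measure on \<open>A\<close> is a finite measure on the line, and level sets of
  positive measure are its atoms.\<close>

lemma countable_positive_level_sets:
  fixes g :: "real^'d::finite \<Rightarrow> real"
  assumes g[measurable]: "g \<in> borel_measurable borel" and A: "bounded A" "A \<in> sets borel"
  shows "countable {e. emeasure lborel ({x. g x = e} \<inter> A) \<noteq> 0}"
proof -
  define N where "N = distr (restrict_space lborel A) borel g"
  have meas: "g \<in> restrict_space lborel A \<rightarrow>\<^sub>M borel"
    by (intro measurable_restrict_space1) simp
  have eq: "emeasure N {e} = emeasure lborel ({x. g x = e} \<inter> A)" for e
  proof -
    have "{x. g x = e} \<inter> A = g -` {e} \<inter> space (restrict_space lborel A)"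
      by (auto simp: space_restrict_space)
    then show ?thesis using A
      by (simp add: N_def emeasure_distr[OF meas] emeasure_restrict_space space_restrict_space)
  qed
  have "finite_measure (restrict_space lborel A)"
    using emeasure_bounded_finite[OF A(1)] A(2)
    by (intro finite_measureI) (simp add: space_restrict_space emeasure_restrict_space top.not_eq_extremum less_top)
  then interpret N: finite_measure N
    unfolding N_def by (rule finite_measure.finite_measure_distr[OF _ meas])
  have "{e. emeasure lborel ({x. g x = e} \<inter> A) \<noteq> 0} = {e. measure N {e} \<noteq> 0}"
    by (simp add: N.emeasure_eq_measure flip: eq)
  then show ?thesis using N.countable_support by simp
qed

text \<open>Only countably many radii are exceptional, and every interval contains others. However
  irregular \<open>K\<close> is, this makes the boundary of a suitable neighbourhood of \<open>K\<close> a null set.\<close>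

lemma null_distance_sphere:
  fixes K :: "(real^'d::finite) set"
  assumes "compact K" "K \<noteq> {}" "e0 > 0"
  obtains e where "0 < e" "e < e0" "{x. infdist x K = e} \<in> null_sets lborel"
proof -
  define A where "A = {x. infdist x K \<le> e0}"
  have A: "compact A" unfolding A_def using assms by (intro compact_infdist_le)
  then have A': "bounded A" "A \<in> sets borel"
    by (auto intro: compact_imp_bounded borel_closed compact_imp_closed)
  have "(\<lambda>x. infdist x K) \<in> borel_measurable borel"
    by (intro borel_measurable_continuous_onI continuous_intros)
  then have "countable {e. emeasure lborel ({x. infdist x K = e} \<inter> A) \<noteq> 0}"
    using A' by (rule countable_positive_level_sets)
  from open_minus_countable[OF this, of "{0<..<e0}"] assms(3)
  obtain e where e: "0 < e" "e < e0" "emeasure lborel ({x. infdist x K = e} \<inter> A) = 0"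
    by auto
  have "{x. infdist x K = e} \<inter> A = {x. infdist x K = e}"
    using e by (auto simp: A_def)
  moreover have "{x. infdist x K = e} \<in> sets borel"
    by (intro borel_closed closed_Collect_eq continuous_intros)
  ultimately show thesis using e that by (auto simp: null_sets_def)
qed

section \<open>Smoothing a measure and its potential\<close>

lemma nn_integral_lborel_translate:
  fixes f :: "'a::euclidean_space \<Rightarrow> ennreal"
  assumes [measurable]: "f \<in> borel_measurable borel"
  shows "(\<integral>\<^sup>+x. f x \<partial>lborel) = (\<integral>\<^sup>+x. f (c + x) \<partial>lborel)"
  by (subst lborel_distr_plus[of c, symmetric]) (simp add: nn_integral_distr)

text \<open>Unlike uniform continuity on \<open>K\<close>, this lets \<open>y\<close> leave \<open>K\<close>, as points do after mollification.\<close>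

lemma uniformly_close_near_compact:
  fixes f :: "'a::{real_normed_vector, heine_borel} \<Rightarrow> real"
  assumes f: "continuous_on UNIV f" and K: "compact K" and "e > 0"
  obtains d where "d > 0" "\<And>y z. z \<in> K \<Longrightarrow> dist y z < d \<Longrightarrow> \<bar>f y - f z\<bar> < e"
proof -
  have "uniformly_continuous_on (\<Union>x\<in>K. cball x 1) f"
    using f K by (intro compact_uniformly_continuous compact_minkowski_sum_cball)
      (auto intro: continuous_on_subset)
  then obtain d where d: "d > 0"
    "\<And>y z. z \<in> (\<Union>x\<in>K. cball x 1) \<Longrightarrow> y \<in> (\<Union>x\<in>K. cball x 1) \<Longrightarrow> dist y z < d \<Longrightarrow> dist (f y) (f z) < e"
    unfolding uniformly_continuous_on_def using \<open>e > 0\<close> by metis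
  show thesis
  proof (rule that[of "min d 1"])
    fix y z assume "z \<in> K" "dist y z < min d 1"
    then show "\<bar>f y - f z\<bar> < e"
      using d(2)[of z y] by (force simp: dist_real_def dist_commute)
  qed (use d in auto)
qed

text \<open>A probability measure and the kernel that mollifies it at the fixed scale \<open>r\<close>. The properties of
  the mollified measure that concern its density, its mass and its potential follow from these few
  properties of the kernel.\<close>

locale kernel_smoothing = prob_space \<rho>
  for \<rho> :: "(real^'d::finite) measure" +
  fixes \<kappa> :: "real^'d \<Rightarrow> real" and r :: real
  assumes sets_eq [measurable_cong]: "sets \<rho> = sets borel"
    and kernel_continuous: "continuous_on UNIV \<kappa>"
    and kernel_nonneg: "\<kappa> x \<ge> 0"
    and kernel_pos_iff: "\<kappa> x > 0 \<longleftrightarrow> norm x < r"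
    and kernel_integral: "(\<integral>x. \<kappa> x \<partial>lborel) = 1"
begin

definition smoothed :: "real^'d \<Rightarrow> real" where
  "smoothed x = (\<integral>y. \<kappa> (x - y) \<partial>\<rho>)"

definition smoothed_measure :: "real^'d \<Rightarrow> (real^'d) measure" where
  "smoothed_measure h = density lborel (\<lambda>x. ennreal (smoothed (x - h)))"

lemma kernel_measurable [measurable]: "\<kappa> \<in> borel_measurable borel"
  using kernel_continuous by (rule borel_measurable_continuous_onI)

lemma kernel_zero: "r \<le> norm x \<Longrightarrow> \<kappa> x = 0"
  using kernel_pos_iff[of x] kernel_nonneg[of x] by linarith

lemma integrable_kernel_times:
  assumes "continuous_on UNIV g"
  shows "integrable lborel (\<lambda>u. \<kappa> u * g u)"
proof -
  have "integrable lborel (\<lambda>u. indicator (cball 0 r) u *\<^sub>R (\<kappa> u * g u))"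
    using assms kernel_continuous
    by (intro borel_integrable_compact continuous_intros) (auto intro: continuous_on_subset)
  moreover have "(\<lambda>u. indicator (cball 0 r) u *\<^sub>R (\<kappa> u * g u)) = (\<lambda>u. \<kappa> u * g u)"
    using kernel_zero by (auto simp: fun_eq_iff indicator_def)
  ultimately show ?thesis by simp
qed

text \<open>Averages against the kernel only see the ball of radius \<open>r\<close>. With constant \<open>g2\<close> this compares an
  average with a single value; with \<open>g2\<close> a translate of \<open>g1\<close> it yields continuity of the average.\<close>

lemma kernel_average_close:
  assumes "continuous_on UNIV g1" "continuous_on UNIV g2"
    and "\<And>u. norm u < r \<Longrightarrow> \<bar>g1 u - g2 u\<bar> \<le> e"
  shows "\<bar>(\<integral>u. \<kappa> u * g1 u \<partial>lborel) - (\<integral>u. \<kappa> u * g2 u \<partial>lborel)\<bar> \<le> e"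
proof -
  have i: "integrable lborel (\<lambda>u. \<kappa> u * g1 u)" "integrable lborel (\<lambda>u. \<kappa> u * g2 u)"
    "integrable lborel (\<lambda>u. \<kappa> u * e)"
    using assms by (intro integrable_kernel_times continuous_on_const; simp)+
  have "\<bar>(\<integral>u. \<kappa> u * g1 u \<partial>lborel) - (\<integral>u. \<kappa> u * g2 u \<partial>lborel)\<bar>
      = \<bar>\<integral>u. \<kappa> u * g1 u - \<kappa> u * g2 u \<partial>lborel\<bar>"
    using i by simp
  also have "\<dots> \<le> (\<integral>u. \<bar>\<kappa> u * g1 u - \<kappa> u * g2 u\<bar> \<partial>lborel)"
    by (rule integral_abs_bound)
  also have "\<dots> \<le> (\<integral>u. \<kappa> u * e \<partial>lborel)"
  proof (rule integral_mono)
    show "\<bar>\<kappa> u * g1 u - \<kappa> u * g2 u\<bar> \<le> \<kappa> u * e" for u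
      using assms(3)[of u] kernel_zero[of u] kernel_nonneg[of u]
      by (cases "norm u < r") (auto simp: abs_mult mult_left_mono simp flip: right_diff_distrib)
  qed (use i in auto)
  also have "\<dots> = e" by (simp add: kernel_integral)
  finally show ?thesis .
qed

lemma integrable_kernel_shift: "integrable \<rho> (\<lambda>y. \<kappa> (x - y))"
proof -
  have "bounded (\<kappa> ` cball 0 r)"
    using kernel_continuous
    by (intro compact_imp_bounded compact_continuous_image) (auto intro: continuous_on_subset)
  then obtain B where B: "\<And>u. norm u \<le> r \<Longrightarrow> \<bar>\<kappa> u\<bar> \<le> B"
    unfolding bounded_iff by (force simp: image_iff)
  have "\<bar>\<kappa> u\<bar> \<le> max B 0" for u
    using B[of u] kernel_zero[of u] by (cases "norm u \<le> r") auto
  then show ?thesis by (intro integrable_const_bound[where B = "max B 0"]) auto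
qed

lemma smoothed_nonneg: "smoothed x \<ge> 0"
  unfolding smoothed_def using kernel_nonneg by simp

lemma smoothed_measurable [measurable]: "smoothed \<in> borel_measurable borel"
  unfolding smoothed_def by measurable

lemma ennreal_smoothed: "ennreal (smoothed x) = (\<integral>\<^sup>+y. ennreal (\<kappa> (x - y)) \<partial>\<rho>)"
  unfolding smoothed_def using integrable_kernel_shift kernel_nonneg
  by (simp add: nn_integral_eq_integral)

text \<open>The integral defining the density at \<open>x\<close> weighs \<open>\<rho>\<close> with a function that is positive exactly on the
  ball of radius \<open>r\<close> about \<open>x\<close>, so it vanishes iff this ball is null; and an open set is null iff it
  misses the support.\<close>

lemma smoothed_pos_iff: "smoothed x > 0 \<longleftrightarrow> (\<exists>z\<in>msupp \<rho>. dist x z < r)"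
proof -
  have "smoothed x = 0 \<longleftrightarrow> (AE y in \<rho>. \<kappa> (x - y) = 0)"
    unfolding smoothed_def using integrable_kernel_shift kernel_nonneg
    by (intro integral_nonneg_eq_0_iff_AE) auto
  also have "(\<lambda>y. \<kappa> (x - y) = 0) = (\<lambda>y. y \<notin> ball x r)"
    using kernel_pos_iff kernel_nonneg
    by (simp add: fun_eq_iff dist_norm) (metis less_le)
  finally have zero_iff: "smoothed x = 0 \<longleftrightarrow> (AE y in \<rho>. y \<notin> ball x r)" .
  show ?thesis
  proof
    assume "\<exists>z\<in>msupp \<rho>. dist x z < r"
    then have "\<not> emeasure \<rho> (ball x r) = 0"
      using not_in_msupp_if_null_open[OF sets_eq open_ball] by auto
    then have "smoothed x \<noteq> 0"
      unfolding zero_iff using AE_iff_null_sets[of "ball x r" \<rho>] sets_eq by auto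
    then show "smoothed x > 0" using smoothed_nonneg[of x] by simp
  next
    assume "smoothed x > 0"
    then have "\<not> (AE y in \<rho>. y \<notin> ball x r)" using zero_iff by simp
    moreover have "AE y in \<rho>. y \<notin> ball x r" if "\<not> (\<exists>z\<in>msupp \<rho>. dist x z < r)"
      using AE_in_msupp[OF sets_eq] by eventually_elim (use that in auto)
    ultimately show "\<exists>z\<in>msupp \<rho>. dist x z < r" by blast
  qed
qed

text \<open>The smoothed measure is the law of an independent sum: the shift, a point drawn from \<open>\<rho>\<close> and a point
  drawn from the kernel. Both the total mass and the potential of the smoothed measure are instances
  of this formula.\<close>

lemma nn_integral_smoothed_measure:
  assumes [measurable]: "f \<in> borel_measurable borel"
  shows "(\<integral>\<^sup>+x. f x \<partial>smoothed_measure h) = (\<integral>\<^sup>+u. ennreal (\<kappa> u) * (\<integral>\<^sup>+z. f (h + z + u) \<partial>\<rho>) \<partial>lborel)"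
proof -
  interpret P: pair_sigma_finite lborel \<rho> ..
  have "(\<integral>\<^sup>+x. f x \<partial>smoothed_measure h) = (\<integral>\<^sup>+x. ennreal (smoothed (x - h)) * f x \<partial>lborel)"
    unfolding smoothed_measure_def by (rule nn_integral_density) auto
  also have "\<dots> = (\<integral>\<^sup>+x. \<integral>\<^sup>+z. ennreal (\<kappa> (x - h - z)) * f x \<partial>\<rho> \<partial>lborel)"
    by (simp add: ennreal_smoothed nn_integral_multc)
  also have "\<dots> = (\<integral>\<^sup>+z. \<integral>\<^sup>+x. ennreal (\<kappa> (x - h - z)) * f x \<partial>lborel \<partial>\<rho>)"
    by (intro P.Fubini'[symmetric]) measurable
  also have "\<dots> = (\<integral>\<^sup>+z. \<integral>\<^sup>+u. ennreal (\<kappa> u) * f (h + z + u) \<partial>lborel \<partial>\<rho>)"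
  proof (rule nn_integral_cong)
    show "(\<integral>\<^sup>+x. ennreal (\<kappa> (x - h - z)) * f x \<partial>lborel) = (\<integral>\<^sup>+u. ennreal (\<kappa> u) * f (h + z + u) \<partial>lborel)" for z
      by (subst nn_integral_lborel_translate[where c = "h + z"]) (auto simp: algebra_simps)
  qed
  also have "\<dots> = (\<integral>\<^sup>+u. \<integral>\<^sup>+z. ennreal (\<kappa> u) * f (h + z + u) \<partial>\<rho> \<partial>lborel)"
    by (intro P.Fubini') measurable
  also have "\<dots> = (\<integral>\<^sup>+u. ennreal (\<kappa> u) * (\<integral>\<^sup>+z. f (h + z + u) \<partial>\<rho>) \<partial>lborel)"
    by (simp add: nn_integral_cmult)
  finally show ?thesis .
qed

lemma prob_space_smoothed_measure: "prob_space (smoothed_measure h)"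
proof (rule prob_spaceI)
  have "integrable lborel \<kappa>"
    using integrable_kernel_times[of "\<lambda>_. 1"] by simp
  then have "(\<integral>\<^sup>+u. ennreal (\<kappa> u) \<partial>lborel) = 1"
    using kernel_nonneg kernel_integral by (simp add: nn_integral_eq_integral)
  then show "emeasure (smoothed_measure h) (space (smoothed_measure h)) = 1"
    using nn_integral_smoothed_measure[of "\<lambda>_. 1" h] emeasure_space_1 by simp
qed

text \<open>Convolutions commute: the potential of the mollified measure is the mollified potential. The
  interaction kernel \<open>w\<close> may be singular and enters only through the function \<open>G\<close>, so
  continuity of the potential survives mollification.\<close>

lemma nn_integral_potential_smoothed:
  assumes [measurable]: "w \<in> borel_measurable borel"
    and G: "continuous_on UNIV G" "\<And>x. G x \<ge> 0"
    and pot: "\<And>x. (\<integral>\<^sup>+z. w (x - z) \<partial>\<rho>) = ennreal (G x)"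
  shows "(\<integral>\<^sup>+y. w (x - y) \<partial>smoothed_measure h) = ennreal (\<integral>u. \<kappa> u * G (x - h - u) \<partial>lborel)"
proof -
  have "(\<integral>\<^sup>+y. w (x - y) \<partial>smoothed_measure h)
      = (\<integral>\<^sup>+u. ennreal (\<kappa> u) * (\<integral>\<^sup>+z. w (x - h - u - z) \<partial>\<rho>) \<partial>lborel)"
    by (subst nn_integral_smoothed_measure) (simp_all add: algebra_simps)
  also have "\<dots> = (\<integral>\<^sup>+u. ennreal (\<kappa> u * G (x - h - u)) \<partial>lborel)"
    using kernel_nonneg by (simp add: pot ennreal_mult G)
  also have "\<dots> = ennreal (\<integral>u. \<kappa> u * G (x - h - u) \<partial>lborel)"
    using kernel_nonneg G
    by (intro nn_integral_eq_integral integrable_kernel_times)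
       (auto intro!: continuous_on_compose2[of UNIV G] continuous_intros)
  finally show ?thesis .
qed

lemma continuous_kernel_average:
  assumes G: "continuous_on UNIV G"
  shows "continuous_on UNIV (\<lambda>x. \<integral>u. \<kappa> u * G (x - u) \<partial>lborel)"
proof (clarsimp simp: continuous_on_iff)
  fix x :: "real^'d" and e :: real assume "e > 0"
  obtain d where d: "d > 0"
    "\<And>y z. z \<in> cball x r \<Longrightarrow> dist y z < d \<Longrightarrow> \<bar>G y - G z\<bar> < e / 2"
    using uniformly_close_near_compact[OF G, of "cball x r" "e / 2"] \<open>e > 0\<close> by auto
  show "\<exists>d>0. \<forall>y. dist y x < d \<longrightarrow>
      dist (\<integral>u. \<kappa> u * G (y - u) \<partial>lborel) (\<integral>u. \<kappa> u * G (x - u) \<partial>lborel) < e"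
  proof (intro exI[of _ d] conjI allI impI d(1))
    fix y assume "dist y x < d"
    have "\<bar>(\<integral>u. \<kappa> u * G (y - u) \<partial>lborel) - (\<integral>u. \<kappa> u * G (x - u) \<partial>lborel)\<bar> \<le> e / 2"
    proof (rule kernel_average_close)
      fix u :: "real^'d" assume "norm u < r"
      then show "\<bar>G (y - u) - G (x - u)\<bar> \<le> e / 2"
        using d(2)[of "x - u" "y - u"] \<open>dist y x < d\<close> by (force simp: dist_norm)
    qed (auto intro!: continuous_on_compose2[OF G] continuous_intros)
    then show "dist (\<integral>u. \<kappa> u * G (y - u) \<partial>lborel) (\<integral>u. \<kappa> u * G (x - u) \<partial>lborel) < e"
      using \<open>e > 0\<close> by (simp add: dist_real_def)
  qed
qed

end

text \<open>The factor \<open>\<epsilon> ^ d\<close> in the rescaling is the Jacobian of \<open>x \<mapsto> \<epsilon> x\<close>.\<close>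

lemma kernel_smoothing_rescale:
  fixes \<rho> :: "(real^'d::finite) measure"
  assumes \<phi>: "mollifier \<phi>" "\<And>x. \<phi> x > 0 \<longleftrightarrow> norm x < 1" and "\<epsilon> > 0"
    and "prob_space \<rho>" "sets \<rho> = sets borel"
  shows "kernel_smoothing \<rho> (rescale \<phi> \<epsilon>) \<epsilon>"
proof -
  interpret prob_space \<rho> by fact
  have "Ck_on 0 \<phi> UNIV" using \<phi>(1) unfolding mollifier_def by blast
  then have \<phi>_cont: "continuous_on UNIV \<phi>" by simp
  then have [measurable]: "\<phi> \<in> borel_measurable borel" by (rule borel_measurable_continuous_onI)
  have \<phi>': "\<And>x. \<phi> x \<ge> 0" "(\<integral>x. \<phi> x \<partial>lborel) = 1"
    using \<phi>(1) by (auto simp: mollifier_def)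
  show ?thesis
  proof
    show "sets \<rho> = sets borel" by fact
    show cont: "continuous_on UNIV (rescale \<phi> \<epsilon>)"
      unfolding rescale_def using \<open>\<epsilon> > 0\<close>
      by (intro continuous_intros continuous_on_compose2[OF \<phi>_cont]) auto
    have [measurable]: "rescale \<phi> \<epsilon> \<in> borel_measurable borel"
      using cont by (rule borel_measurable_continuous_onI)
    show "0 \<le> rescale \<phi> \<epsilon> x" for x
      using \<phi>' \<open>\<epsilon> > 0\<close> by (simp add: rescale_def)
    show "(0 < rescale \<phi> \<epsilon> x) = (norm x < \<epsilon>)" for x
      using \<phi>(2) \<open>\<epsilon> > 0\<close> by (simp add: rescale_def zero_less_divide_iff field_simps)
    have "(\<integral>x. rescale \<phi> \<epsilon> x \<partial>lborel)
        = (\<integral>x. rescale \<phi> \<epsilon> x \<partial>density (distr lborel borel (\<lambda>x::real^'d. 0 + \<epsilon> *\<^sub>R x)) (\<lambda>_. ennreal (\<bar>\<epsilon>\<bar> ^ DIM(real^'d))))"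
      using lborel_affine[of \<epsilon> "0::real^'d"] \<open>\<epsilon> > 0\<close> by simp
    also have "\<dots> = (\<integral>x. \<phi> x \<partial>lborel)"
      using \<open>\<epsilon> > 0\<close> by (subst integral_density) (simp_all add: integral_distr, simp add: rescale_def)
    finally show "(\<integral>x. rescale \<phi> \<epsilon> x \<partial>lborel) = 1" using \<phi>' by simp
  qed
qed

section \<open>Admissible domains and the regularised minimizer\<close>

text \<open>Each admissible domain lies above a continuous graph, or is a half line or the whole space, and so it
  moves into its own interior under arbitrarily small shifts in one direction. This makes room for
  the spreading that mollification causes at the boundary of the domain.\<close>

lemma admissible_domain_push_inside:
  fixes D :: "(real^'d::finite) set"
  assumes "admissible_domain D" "\<delta> > 0"
  obtains h where "norm h < \<delta>" "\<And>x. x \<in> D \<Longrightarrow> x + h \<in> interior D"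
proof -
  consider "D = UNIV"
    | x0 where "CARD('d) = 1" "D = {x. \<forall>i. x $ i \<ge> x0}"
    | k \<Phi> where "continuous_on {y. y $ k = 0} \<Phi>"
        "D = {x. x $ k \<ge> \<Phi> (\<chi> i. if i = k then 0 else x $ i)}"
    using assms(1) unfolding admissible_domain_def by blast
  then show thesis
  proof cases
    case 1
    with \<open>\<delta> > 0\<close> show ?thesis by (intro that[of 0]) auto
  next
    case 2
    define h where "h = (\<chi> i::'d. \<delta> / 2)"
    have "norm h \<le> (\<Sum>i\<in>UNIV. \<bar>h $ i\<bar>)" by (rule norm_le_l1_cart)
    also have "\<dots> < \<delta>" using 2(1) \<open>\<delta> > 0\<close> by (simp add: h_def)
    finally have "norm h < \<delta>" .
    moreover have "open (\<Inter>i. {x::real^'d. x $ i > x0})"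
      by (intro open_INT ballI finite open_Collect_less continuous_intros)
    then have "(\<Inter>i. {x. x $ i > x0}) \<subseteq> interior D"
      unfolding 2(2) by (intro interior_maximal) (auto intro: less_imp_le)
    moreover have "x + h \<in> (\<Inter>i. {x. x $ i > x0})" if "x \<in> D" for x
    proof -
      have "x0 < x $ i + \<delta> / 2" for i
        using that \<open>\<delta> > 0\<close> unfolding 2(2) by (auto dest: spec[of _ i])
      then show ?thesis by (simp add: h_def)
    qed
    ultimately show ?thesis using that by blast
  next
    case 3
    define p where "p = (\<lambda>x::real^'d. \<chi> i. if i = k then 0 else x $ i)"
    define h where "h = (\<delta> / 2) *\<^sub>R (axis k 1 :: real^'d)"
    have "norm h < \<delta>" using \<open>\<delta> > 0\<close> by (simp add: h_def)
    \<comment> \<open>The shift is along the axis \<open>k\<close>, so it leaves the argument \<open>p x\<close> of \<open>\<Phi>\<close> unchanged.\<close>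
    have "continuous_on UNIV (\<lambda>x::real^'d. if i = k then 0 else x $ i)" for i
      by (cases "i = k") (auto intro: continuous_intros)
    then have "continuous_on UNIV p"
      unfolding p_def by (intro continuous_on_vec_lambda)
    then have "continuous_on UNIV (\<lambda>x. \<Phi> (p x))"
      by (rule continuous_on_compose2[OF 3(1)]) (auto simp: p_def)
    then have inside: "{x. \<Phi> (p x) < x $ k} \<subseteq> interior D"
      unfolding 3(2) by (intro interior_maximal open_Collect_less continuous_intros) (auto simp: p_def)
    have "x + h \<in> interior D" if "x \<in> D" for x
    proof -
      have "p (x + h) = p x" by (simp add: p_def h_def vec_eq_iff axis_def)
      moreover have "\<Phi> (p x) \<le> x $ k" using that by (simp add: 3(2) p_def)
      ultimately have "\<Phi> (p (x + h)) < (x + h) $ k" using \<open>\<delta> > 0\<close> by (simp add: h_def axis_def)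
      with inside show ?thesis by blast
    qed
    with \<open>norm h < \<delta>\<close> show ?thesis by (rule that)
  qed
qed

lemma conv_measure_nonneg_kernel:
  assumes "\<And>x. W x \<ge> 0"
  shows "conv_measure W M x = enn2ereal (\<integral>\<^sup>+y. e2ennreal (W (x - y)) \<partial>M)"
proof -
  have "e2ennreal (- W y) = 0" for y using assms[of y] by (simp add: e2ennreal_neg)
  then show ?thesis by (simp add: conv_measure_def eint_def zero_ennreal.rep_eq)
qed

theorem proposition1p17:
  fixes W :: "real^'d::finite \<Rightarrow> ereal"
    and U :: "real^'d \<Rightarrow> real"
    and U_inf C0 :: real
    and D :: "(real^'d) set"
    and \<rho> :: "(real^'d) measure"
  assumes "essentially_convex W"
    and "\<And>x. W x \<ge> 0"
    and "U0 (\<lambda>x. ereal (U x))"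
    and "continuous_on UNIV U"
    and "(U \<longlongrightarrow> U_inf) at_infinity"
    and "admissible_domain D"
    and "is_minimizer W (\<lambda>x. ereal (U x)) D \<rho>"
    and "is_EL_constant W (\<lambda>x. ereal (U x)) D \<rho> C0"
    and "C0 < U_inf"
    and "real_continuous (conv_measure W \<rho>)"
  shows "compact (msupp \<rho>) \<and>
    (\<exists>\<phi> \<epsilon> h \<rho>'. mollifier \<phi> \<and> \<epsilon> > 0 \<and> \<rho>' = translated_mollification \<rho> \<phi> \<epsilon> h \<and>
       \<rho>' \<in> prob_measures D \<and> compact (msupp \<rho>') \<and> is_loc_int_function \<rho>' \<and>
       (\<exists>S. open S \<and> msupp \<rho>' = closure S \<and> frontier S \<in> null_sets lborel \<and>
            (SUP x\<in>S. gen_potential W (\<lambda>x. ereal (U x)) \<rho>' x) < ereal U_inf) \<and>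
       real_continuous (conv_measure W \<rho>'))"
proof -
  define K where "K = msupp \<rho>"
  have \<rho>: "sets \<rho> = sets borel" "prob_space \<rho>" "K \<subseteq> D"
    using assms(7) by (auto simp: is_minimizer_def prob_measures_def K_def)
  interpret \<rho>: prob_space \<rho> by fact
  define w where "w = (\<lambda>x. e2ennreal (W x))"
  have "W \<in> borel_measurable borel"
    using assms(1) by (auto simp: essentially_convex_def W0_def locally_integrable_def)
  then have w_meas: "w \<in> borel_measurable borel" unfolding w_def by measurable
  have conv: "conv_measure W M x = enn2ereal (\<integral>\<^sup>+y. w (x - y) \<partial>M)" for M x
    unfolding w_def using assms(2) by (rule conv_measure_nonneg_kernel)
  define G where "G = (\<lambda>x. real_of_ereal (conv_measure W \<rho> x))"
  have G_eq: "conv_measure W \<rho> x = ereal (G x)" for x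
    using assms(10) by (simp add: real_continuous_def G_def ereal_real)
  then have "continuous_on UNIV (\<lambda>x. ereal (G x))"
    using assms(10) by (simp add: real_continuous_def cong: continuous_on_cong)
  then have G_cont: "continuous_on UNIV G"
    by (simp add: continuous_on_def)
  have G_nonneg: "G x \<ge> 0" for x
    using conv[of \<rho> x] G_eq[of x] by (metis enn2ereal_nonneg ereal_less_eq(5))
  have G_pot: "(\<integral>\<^sup>+z. w (x - z) \<partial>\<rho>) = ennreal (G x)" for x
    using conv[of \<rho> x] G_eq[of x] by (metis e2ennreal_enn2ereal e2ennreal_ereal)
  have EL: "G z + U z \<le> C0" if "z \<in> K" for z
    using assms(8) that G_eq[of z] by (auto simp: is_EL_constant_def gen_potential_def K_def)

  \<comment> \<open>Since \<open>G\<close> is nonnegative, \<open>U \<le> C0\<close> on the support, which fails far from the origin.\<close>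
  have "\<forall>\<^sub>F x in at_infinity. C0 < U x"
    using assms(5,9) by (rule order_tendstoD)
  then obtain b where b: "\<And>x. norm x \<ge> b \<Longrightarrow> C0 < U x"
    by (auto simp: eventually_at_infinity)
  have "norm z \<le> b" if "z \<in> K" for z
    using EL[OF that] G_nonneg[of z] b[of z] by force
  then have "bounded K" by (auto simp: bounded_iff)
  then have K_compact: "compact K"
    using msupp_closed[OF \<rho>(1)] by (simp add: K_def compact_eq_bounded_closed)
  have "K \<noteq> {}"
    using AE_in_msupp[OF \<rho>(1)] by (auto simp: K_def)

  \<comment> \<open>One third of the gap is for the variation of \<open>G\<close> and one for that of \<open>U\<close>; the last one keeps the
     inequality strict when passing to the supremum.\<close>
  define \<delta> where "\<delta> = (U_inf - C0) / 3"
  have "\<delta> > 0" using assms(9) by (simp add: \<delta>_def)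
  obtain d1 where d1: "d1 > 0" "\<And>y z. z \<in> K \<Longrightarrow> dist y z < d1 \<Longrightarrow> \<bar>G y - G z\<bar> < \<delta>"
    using uniformly_close_near_compact[OF G_cont K_compact \<open>\<delta> > 0\<close>] by metis
  obtain d2 where d2: "d2 > 0" "\<And>y z. z \<in> K \<Longrightarrow> dist y z < d2 \<Longrightarrow> \<bar>U y - U z\<bar> < \<delta>"
    using uniformly_close_near_compact[OF assms(4) K_compact \<open>\<delta> > 0\<close>] by metis
  \<comment> \<open>The shift comes first and the mollification radius second, as the latter must fit into the
     margin that the shift has created.\<close>
  obtain h where h: "norm h < d2 / 2" "\<And>x. x \<in> D \<Longrightarrow> x + h \<in> interior D"
    using admissible_domain_push_inside[OF assms(6), of "d2 / 2"] d2(1) by auto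
  define K' where "K' = (\<lambda>z. h + z) ` K"
  have K'_compact: "compact K'"
    unfolding K'_def using K_compact by (rule compact_translation)
  obtain d3 where d3: "d3 > 0" "(\<Union>x\<in>K'. cball x d3) \<subseteq> interior D"
  proof (rule compact_subset_open_imp_cball_epsilon_subset[OF K'_compact open_interior])
    show "K' \<subseteq> interior D" using h(2) \<rho>(3) by (auto simp: K'_def add.commute)
  qed
  \<comment> \<open>The three bounds: averages of \<open>G\<close> reach up to \<open>2 * e\<close> from the support, \<open>U\<close> is evaluated up to
     \<open>e + norm h\<close> from it, and the \<open>e\<close>-neighbourhood of \<open>K'\<close> has to stay in \<open>D\<close>.\<close>
  obtain e where e: "0 < e" "e < Min {d1 / 2, d2 / 2, d3}"
    and sphere: "{x. infdist x K = e} \<in> null_sets lborel"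
    using null_distance_sphere[OF K_compact \<open>K \<noteq> {}\<close>, of "Min {d1 / 2, d2 / 2, d3}"]
      d1(1) d2(1) d3(1) by auto
  obtain \<phi> :: "real^'d \<Rightarrow> real" where \<phi>: "mollifier \<phi>" "\<And>x. \<phi> x > 0 \<longleftrightarrow> norm x < 1"
    using mollifier_exists by metis
  interpret kernel_smoothing \<rho> "rescale \<phi> e" e
    using kernel_smoothing_rescale[OF \<phi> e(1) \<rho>(2,1)] .
  have \<rho>'_eq: "translated_mollification \<rho> \<phi> e h = smoothed_measure h"
    by (simp add: translated_mollification_def smoothed_measure_def mollify_def smoothed_def)
  define S where "S = {x. smoothed (x - h) > 0}"
  have near_K: "\<exists>z\<in>K. dist (x - h) z = infdist (x - h) K" for x
    using infdist_attains_inf[OF compact_imp_closed[OF K_compact] \<open>K \<noteq> {}\<close>, of "x - h"] by metis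
  have S_eq: "S = {x. infdist (x - h) K < e}"
  proof -
    have "(\<exists>z\<in>K. dist (x - h) z < e) \<longleftrightarrow> infdist (x - h) K < e" for x
      using near_K[of x] infdist_le[of _ K "x - h"] by (metis le_less_trans)
    then show ?thesis by (simp add: S_def smoothed_pos_iff K_def)
  qed
  have S_open: "open S"
    unfolding S_eq by (intro open_Collect_less continuous_intros)
  have supp: "msupp (smoothed_measure h) = closure S"
    using S_open unfolding smoothed_measure_def S_def by (intro msupp_density_lborel) auto
  have closure_S: "closure S \<subseteq> {x. infdist (x - h) K \<le> e}"
    unfolding S_eq by (intro closure_minimal closed_Collect_le continuous_intros) auto
  have closure_S_near: "closure S \<subseteq> (\<Union>x\<in>K'. cball x d3)"
  proof
    fix x assume "x \<in> closure S"
    then obtain z where z: "z \<in> K" "dist (x - h) z \<le> e"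
      using closure_S near_K[of x] by auto
    then have "x \<in> cball (h + z) d3"
      using e(2) by (auto simp: dist_norm norm_minus_commute algebra_simps)
    with z(1) show "x \<in> (\<Union>x\<in>K'. cball x d3)" by (auto simp: K'_def)
  qed
  have "compact (closure S)"
    using bounded_subset[OF compact_imp_bounded[OF compact_minkowski_sum_cball[OF K'_compact]] closure_S_near]
    by (simp add: compact_eq_bounded_closed)
  have frontier_S: "frontier S \<in> null_sets lborel"
  proof (rule null_sets_subset)
    show "{x. x - h \<in> {x. infdist x K = e}} \<in> null_sets lborel"
      using sphere by (rule null_sets_translation)
    show "frontier S \<subseteq> {x. x - h \<in> {x. infdist x K = e}}"
      using closure_S S_open by (auto simp: frontier_def interior_open S_eq)
  qed simp
  have "closure S \<subseteq> D"
    using closure_S_near d3(2) interior_subset[of D] by blast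
  moreover have "sets (smoothed_measure h) = sets borel"
    by (simp add: smoothed_measure_def)
  ultimately have in_D: "smoothed_measure h \<in> prob_measures D"
    using prob_space_smoothed_measure by (simp add: prob_measures_def supp)
  have loc_int: "is_loc_int_function (smoothed_measure h)"
    unfolding is_loc_int_function_def
  proof (intro exI conjI allI)
    show "smoothed_measure h = density lborel (\<lambda>x. ennreal (smoothed (x - h)))"
      by (rule smoothed_measure_def)
    have "(\<integral>\<^sup>+x\<in>A. ennreal (smoothed (x - h)) \<partial>lborel) < \<infinity>" if "compact A" for A
    proof -
      have "(\<integral>\<^sup>+x\<in>A. ennreal (smoothed (x - h)) \<partial>lborel) = emeasure (smoothed_measure h) A"
        using that unfolding smoothed_measure_def
        by (subst emeasure_density) (auto intro: borel_compact)
      also have "\<dots> \<le> 1"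
        using prob_space_smoothed_measure by (rule prob_space.measure_le_1)
      finally show ?thesis by (auto intro: le_less_trans)
    qed
    then show "locally_integrable (\<lambda>x. ereal (smoothed (x - h)))"
      by (simp add: locally_integrable_def smoothed_nonneg)
  qed (rule smoothed_nonneg)

  define V where "V = (\<lambda>x. \<integral>u. rescale \<phi> e u * G (x - u) \<partial>lborel)"
  have conv': "conv_measure W (smoothed_measure h) x = ereal (V (x - h))" for x
  proof -
    have "V (x - h) \<ge> 0" unfolding V_def using kernel_nonneg G_nonneg by simp
    then show ?thesis
      unfolding conv nn_integral_potential_smoothed[OF w_meas G_cont G_nonneg G_pot]
      by (simp add: V_def enn2ereal_ennreal)
  qed
  have conv'_cont: "real_continuous (conv_measure W (smoothed_measure h))"
    using continuous_kernel_average[OF G_cont] unfolding V_def[symmetric] real_continuous_def conv'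
    by (auto intro!: continuous_intros continuous_on_compose2[of UNIV V])
  have "gen_potential W (\<lambda>x. ereal (U x)) (smoothed_measure h) x \<le> ereal (C0 + 2 * \<delta>)" if "x \<in> S" for x
  proof -
    obtain z where z: "z \<in> K" "dist (x - h) z < e"
      using \<open>x \<in> S\<close> near_K[of x] by (auto simp: S_eq)
    have "\<bar>V (x - h) - (\<integral>u. rescale \<phi> e u * G z \<partial>lborel)\<bar> \<le> \<delta>"
      unfolding V_def
    proof (rule kernel_average_close)
      fix u :: "real^'d" assume "norm u < e"
      then have "dist (x - h - u) z < d1"
        using z(2) e(2) norm_triangle_ineq4[of "x - h - z" u] by (simp add: dist_norm algebra_simps)
      then show "\<bar>G (x - h - u) - G z\<bar> \<le> \<delta>"
        using d1(2)[OF z(1)] by (simp add: less_imp_le)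
    qed (auto intro!: continuous_on_compose2[OF G_cont] continuous_intros)
    \<comment> \<open>The kernel has mass 1, so the average of the constant \<open>G z\<close> is \<open>G z\<close>.\<close>
    then have "V (x - h) \<le> G z + \<delta>" by (simp add: kernel_integral)
    moreover have "dist x z < d2"
      using z(2) e(2) h(1) norm_triangle_ineq[of "x - h - z" h] by (simp add: dist_norm algebra_simps)
    then have "U x \<le> U z + \<delta>" using d2(2)[OF z(1)] by force
    ultimately show ?thesis
      using EL[OF z(1)] by (simp add: gen_potential_def conv')
  qed
  then have "(SUP x\<in>S. gen_potential W (\<lambda>x. ereal (U x)) (smoothed_measure h) x) \<le> ereal (C0 + 2 * \<delta>)"
    by (rule SUP_least)
  also have "\<dots> < ereal U_inf" using assms(9) by (simp add: \<delta>_def field_simps)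
  finally have "(SUP x\<in>S. gen_potential W (\<lambda>x. ereal (U x)) (smoothed_measure h) x) < ereal U_inf" .
  then show ?thesis
    using K_compact \<phi>(1) e(1) \<rho>'_eq in_D \<open>compact (closure S)\<close> loc_int S_open supp frontier_S conv'_cont
    unfolding K_def by metis
qed

end
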